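(* Let $r$ be a complex number and $n\ge0$ an integer. Then, as polynomials in $x$, $$D_n^{(r)}(x)^2=\sum_{m=0}^n\binom{n+2r+m}{n-m}(-1)^{n-m}\prod_{j=m+1}^n j(2r+j)\prod_{k=1}^m\big(x^2+(2r+2k-1)^2\big),$$ where empty products equal $1$.
   Context: For a complex number $a$ and integer $k\ge0$, $\binom{a}{k}=a(a-1)\cdots(a-k+1)/k!$. The polynomials $D_n^{(r)}(x)$ are defined by $D_{-1}^{(r)}(x)=0$, $D_0^{(r)}(x)=1$ and $D_{n+1}^{(r)}(x)=xD_n^{(r)}(x)-n(n+2r)D_{n-1}^{(r)}(x)$ for $n\ge0$. *)

theory Defs
  imports Complex_Main "HOL-Computational_Algebra.Polynomial"
begin

text \<open>
  The recurrence at index \<open>0\<close> involves \<open>D\<close> at index \<open>-1\<close>, which is the zero polynomial;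
  it therefore gives \<open>x\<close> at index \<open>1\<close>, which is the second equation below. The third equation
  is the recurrence at index \<open>n + 1\<close>.
\<close>

fun D :: "complex \<Rightarrow> nat \<Rightarrow> complex poly" where
  "D r 0 = 1"
| "D r (Suc 0) = [:0, 1:]"
| "D r (Suc (Suc n)) =
     [:0, 1:] * D r (Suc n) - smult (of_nat (Suc n) * (of_nat (Suc n) + 2 * r)) (D r n)"

end

theory Submission
  imports Defs
begin

text \<open>
  With \<open>b\<^sub>n = n (n + 2 r)\<close>, the squares \<open>S\<^sub>n = D\<^sub>n\<^sup>2\<close> and the mixed products
  \<open>U\<^sub>n = x D\<^sub>n D\<^bsub>n-1\<^esub>\<close> satisfy the linear system
  \<open>U\<^bsub>n+1\<^esub> = x\<^sup>2 S\<^sub>n - b\<^sub>n U\<^sub>n\<close> and \<open>S\<^bsub>n+1\<^esub> = U\<^bsub>n+1\<^esub> - b\<^sub>n U\<^sub>n + b\<^sub>n\<^sup>2 S\<^bsub>n-1\<^esub>\<close>.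
  Both sequences have hypergeometric coefficients in the basis of the products
  \<open>P\<^sub>m\<close> of the \<open>x\<^sup>2 + (2 r + 2 k - 1)\<^sup>2\<close> with \<open>1 \<le> k \<le> m\<close>, on which \<open>x\<^sup>2\<close> acts by
  \<open>x\<^sup>2 P\<^sub>m = P\<^bsub>m+1\<^esub> - (2 r + 2 m + 1)\<^sup>2 P\<^sub>m\<close>. The system thus reduces to rational identities
  between the coefficients.
\<close>

definition shifted_square_prod :: "complex \<Rightarrow> nat \<Rightarrow> complex poly" where
  "shifted_square_prod c m = (\<Prod>k = 1..m. [:0, 1:]\<^sup>2 + [:(c + 2 * of_nat k - 1)\<^sup>2:])"

text \<open>Here \<open>c\<close> stands for \<open>2 * r\<close>. Pochhammer symbols replace the
  binomial and the product because their quotients at neighbouring indices are plain linear factors.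
  The value 0 for \<open>m > n\<close> lets sums run past \<open>n\<close>.\<close>

definition sq_coeff :: "complex \<Rightarrow> nat \<Rightarrow> nat \<Rightarrow> complex" where
  "sq_coeff c n m = (if m \<le> n then
     (-1) ^ (n - m) * pochhammer (c + 2 * of_nat m + 1) (n - m) / fact (n - m)
       * pochhammer (of_nat m + 1) (n - m) * pochhammer (c + of_nat m + 1) (n - m)
   else 0)"

text \<open>
  The coefficients of \<open>U\<^bsub>n+1\<^esub>\<close>, found by solving the recurrence of \<open>S\<close> for \<open>U\<close>.
\<close>

definition mixed_coeff :: "complex \<Rightarrow> nat \<Rightarrow> nat \<Rightarrow> complex" where
  "mixed_coeff c n m = (if m = Suc n then 1 else
     - sq_coeff c n m * ((c + 2 * of_nat m) * (of_nat n + 1) * (c + of_nat n + 1)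
         / of_nat (Suc n - m) + (c + of_nat n + of_nat m + 1)))"

lemma sq_coeff_self [simp]: "sq_coeff c n n = 1"
  by (simp add: sq_coeff_def)

lemma sq_coeff_eq_0 [simp]: "n < m \<Longrightarrow> sq_coeff c n m = 0"
  by (simp add: sq_coeff_def)

lemma sq_coeff_Suc:
  "sq_coeff c (Suc (m + k)) m =
     - sq_coeff c (m + k) m * (c + 2 * of_nat m + of_nat k + 1)
       * (of_nat m + of_nat k + 1) * (c + of_nat m + of_nat k + 1) / (of_nat k + 1)"
proof -
  have *: "Suc (m + k) - m = Suc k" by simp
  show ?thesis
    by (simp add: sq_coeff_def * pochhammer_Suc fact_Suc add_ac mult_ac del: of_nat_Suc)
      (simp add: add_ac)
qed

text \<open>Passing from (n, m) to (n + 1, m - 1) raises the length n - m by two, so the sign is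
  kept. The symbol based at \<open>c + 2 * of_nat m + 1\<close> gains two factors in front; the
  other two gain one at each end.\<close>

lemma sq_coeff_pred:
  "sq_coeff c (Suc (m + Suc k)) m =
     sq_coeff c (Suc (m + k)) (Suc m) * (c + 2 * of_nat m + 1) * (c + 2 * of_nat m + 2)
       * (of_nat m + 1) * (of_nat m + of_nat k + 2) * (c + of_nat m + 1) * (c + of_nat m + of_nat k + 2)
       / ((of_nat k + 1) * (of_nat k + 2))"
proof -
  have *: "Suc (m + Suc k) - m = Suc (Suc k)" by simp
  have p1: "pochhammer (c + 2 * of_nat m + 1) (Suc (Suc k)) =
     (c + 2 * of_nat m + 1) * (c + 2 * of_nat m + 2) * pochhammer (c + 2 * of_nat m + 3) k"
    by (simp add: pochhammer_rec add_ac)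
  have p2: "pochhammer (a + 1) (Suc (Suc k)) =
     (a + 1) * (a + of_nat k + 2) * pochhammer (a + 2) k" for a :: complex
    using pochhammer_Suc[of "a + 2" k] by (simp add: pochhammer_rec add_ac)
  have lhs: "sq_coeff c (Suc (m + Suc k)) m =
     (-1) ^ k * pochhammer (c + 2 * of_nat m + 1) (Suc (Suc k)) / fact (Suc (Suc k))
       * pochhammer (of_nat m + 1) (Suc (Suc k)) * pochhammer (c + of_nat m + 1) (Suc (Suc k))"
    by (simp only: sq_coeff_def *) simp
  have rhs: "sq_coeff c (Suc (m + k)) (Suc m) =
     (-1) ^ k * pochhammer (c + 2 * of_nat m + 3) k / fact k
       * pochhammer (of_nat m + 2) k * pochhammer (c + of_nat m + 2) k"
    by (simp add: sq_coeff_def add_ac)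
  have f: "fact (Suc (Suc k)) = (of_nat k + 1) * (of_nat k + 2) * (fact k :: complex)"
    by (simp add: algebra_simps)
  show ?thesis
    unfolding lhs rhs p1 p2[of "of_nat m"] p2[of "c + of_nat m"] f
    by (simp only: times_divide_eq_left times_divide_eq_right divide_divide_eq_left mult_ac)
qed

text \<open>Coefficient form of the recurrence for U. Away from \<open>m = Suc n\<close>, every term
  is a rational multiple of the single value \<open>v\<close>, so clearing denominators leaves a
  polynomial identity.\<close>

lemma mixed_coeff_Suc:
  assumes "m \<le> Suc n"
  shows "mixed_coeff c (Suc n) m =
    (if m = 0 then 0 else sq_coeff c (Suc n) (m - 1))
      - (c + 2 * of_nat m + 1)\<^sup>2 * sq_coeff c (Suc n) m
      - of_nat (Suc n) * (of_nat (Suc n) + c) * mixed_coeff c n m"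
proof (cases "m = Suc n")
  case True
  have "sq_coeff c (Suc n) n = - (c + 2 * of_nat n + 1) * (of_nat n + 1) * (c + of_nat n + 1)"
    using sq_coeff_Suc[of c n 0] by simp
  with True show ?thesis
    by (simp add: mixed_coeff_def power2_eq_square algebra_simps)
next
  case False
  with assms obtain k where n: "n = m + k"
    using le_Suc_ex le_SucE by metis
  define v where "v = sq_coeff c (m + k) m"
  have nz: "(of_nat k + 1 :: complex) \<noteq> 0" "(of_nat k + 2 :: complex) \<noteq> 0"
    using of_nat_neq_0[of k, where 'a=complex] of_nat_neq_0[of "Suc k", where 'a=complex]
    by (simp_all add: add_ac)
  \<comment> \<open>The factor \<open>of_nat m\<close> makes the formula cover \<open>m = 0\<close>
    too.\<close>
  have pred: "(if m = 0 then 0 else sq_coeff c (Suc n) (m - 1)) =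
    v * (c + 2 * of_nat m - 1) * (c + 2 * of_nat m) * of_nat m * (of_nat m + of_nat k + 1)
      * (c + of_nat m) * (c + of_nat m + of_nat k + 1) / ((of_nat k + 1) * (of_nat k + 2))"
  proof (cases m)
    case (Suc l)
    then show ?thesis
      using sq_coeff_pred[of c l k] by (simp add: n v_def add_ac)
  qed simp
  have d: "Suc n - m = Suc k" "Suc (Suc n) - m = Suc (Suc k)"
    using n by auto
  show ?thesis
    unfolding pred mixed_coeff_def d
    unfolding n sq_coeff_Suc v_def[symmetric]
    using nz by (simp add: add_ac) (simp add: divide_simps, algebra)
qed

text \<open>Coefficient form of the recurrence for S, by the same reduction to
  \<open>v\<close>.\<close>

lemma sq_coeff_Suc_Suc:
  assumes "m \<le> Suc n"
  shows "sq_coeff c (Suc (Suc n)) m = mixed_coeff c (Suc n) m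
      - of_nat (Suc n) * (of_nat (Suc n) + c) * mixed_coeff c n m
      + (of_nat (Suc n) * (of_nat (Suc n) + c))\<^sup>2 * sq_coeff c n m"
proof (cases "m = Suc n")
  case True
  have "sq_coeff c (Suc (Suc n)) (Suc n) = - (c + 2 * of_nat n + 3) * (of_nat n + 2) * (c + of_nat n + 2)"
    using sq_coeff_Suc[of c "Suc n" 0] by (simp add: add_ac)
  then show ?thesis
    unfolding True by (simp only:) (simp add: mixed_coeff_def power2_eq_square algebra_simps)
next
  case False
  with assms obtain k where n: "n = m + k"
    using le_Suc_ex le_SucE by metis
  define v where "v = sq_coeff c (m + k) m"
  have nz: "(of_nat k + 1 :: complex) \<noteq> 0" "(of_nat k + 2 :: complex) \<noteq> 0"
    using of_nat_neq_0[of k, where 'a=complex] of_nat_neq_0[of "Suc k", where 'a=complex]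
    by (simp_all add: add_ac)
  have d: "Suc n - m = Suc k" "Suc (Suc n) - m = Suc (Suc k)"
    using n by auto
  have s2: "sq_coeff c (Suc (Suc (m + k))) m =
     - sq_coeff c (Suc (m + k)) m * (c + 2 * of_nat m + of_nat k + 2)
       * (of_nat m + of_nat k + 2) * (c + of_nat m + of_nat k + 2) / (of_nat k + 2)"
    using sq_coeff_Suc[of c m "Suc k"] by (simp add: add_ac)
  show ?thesis
    unfolding mixed_coeff_def d
    unfolding n s2 sq_coeff_Suc v_def[symmetric]
    using nz by (simp add: add_ac) (simp add: divide_simps, algebra)
qed

lemma smult_sum_right: "smult a (\<Sum>i\<in>A. f i) = (\<Sum>i\<in>A. smult a (f i))"
  by (induction A rule: infinite_finite_induct) (simp_all add: smult_add_right)

lemma X_sq_mult_shifted_square_prod: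
  "[:0, 1:]\<^sup>2 * shifted_square_prod c m =
     shifted_square_prod c (Suc m) - smult ((c + 2 * of_nat m + 1)\<^sup>2) (shifted_square_prod c m)"
  by (simp add: shifted_square_prod_def algebra_simps)

lemma X_sq_mult_sum:
  "[:0, 1:]\<^sup>2 * (\<Sum>m\<le>n. smult (sq_coeff c n m) (shifted_square_prod c m)) =
     (\<Sum>m\<le>Suc n. smult ((if m = 0 then 0 else sq_coeff c n (m - 1))
       - (c + 2 * of_nat m + 1)\<^sup>2 * sq_coeff c n m) (shifted_square_prod c m))"
proof -
  have "[:0, 1:]\<^sup>2 * (\<Sum>m\<le>n. smult (sq_coeff c n m) (shifted_square_prod c m)) =
     (\<Sum>m\<le>n. smult (sq_coeff c n m) (shifted_square_prod c (Suc m)))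
     - (\<Sum>m\<le>n. smult ((c + 2 * of_nat m + 1)\<^sup>2 * sq_coeff c n m) (shifted_square_prod c m))"
    by (simp only: sum_distrib_left mult_smult_right X_sq_mult_shifted_square_prod smult_diff_right
        sum_subtractf smult_smult mult.commute[of "sq_coeff c n _"])
  also have "(\<Sum>m\<le>n. smult (sq_coeff c n m) (shifted_square_prod c (Suc m))) =
     (\<Sum>m\<le>Suc n. smult (if m = 0 then 0 else sq_coeff c n (m - 1)) (shifted_square_prod c m))"
    by (subst sum.atMost_Suc_shift) simp
  \<comment> \<open>The extra term vanishes because \<open>sq_coeff c n (Suc n)\<close> is
    0.\<close>
  also have "(\<Sum>m\<le>n. smult ((c + 2 * of_nat m + 1)\<^sup>2 * sq_coeff c n m) (shifted_square_prod c m)) =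
     (\<Sum>m\<le>Suc n. smult ((c + 2 * of_nat m + 1)\<^sup>2 * sq_coeff c n m) (shifted_square_prod c m))"
    by simp
  finally show ?thesis
    by (simp only: sum_subtractf[symmetric] smult_diff_left[symmetric])
qed

text \<open>The claims need a joint induction, since S depends on its value two indices back and on
  U. The factor x makes the odd polynomial \<open>D r (Suc n) * D r n\<close> even, hence
  expressible in the basis.\<close>

lemma D_sq_and_mixed_expansion:
  "(D r n)\<^sup>2 = (\<Sum>m\<le>n. smult (sq_coeff (2 * r) n m) (shifted_square_prod (2 * r) m)) \<and>
   (D r (Suc n))\<^sup>2 =
     (\<Sum>m\<le>Suc n. smult (sq_coeff (2 * r) (Suc n) m) (shifted_square_prod (2 * r) m)) \<and>
   [:0, 1:] * D r (Suc n) * D r n =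
     (\<Sum>m\<le>Suc n. smult (mixed_coeff (2 * r) n m) (shifted_square_prod (2 * r) m))"
proof (induction n)
  case 0
  show ?case
    using sq_coeff_Suc[of "2 * r" 0 0]
    by (simp add: shifted_square_prod_def mixed_coeff_def power2_eq_square algebra_simps)
next
  case (Suc n)
  define c where "c = 2 * r"
  define b where "b = of_nat (Suc n) * (of_nat (Suc n) + c)"
  let ?P = "shifted_square_prod c"
  let ?S = "\<lambda>n. (\<Sum>m\<le>n. smult (sq_coeff c n m) (?P m))"
  let ?U = "\<lambda>n. (\<Sum>m\<le>Suc n. smult (mixed_coeff c n m) (?P m))"
  note IH = Suc.IH[folded c_def, THEN conjunct1] Suc.IH[folded c_def, THEN conjunct2, THEN conjunct1]
    Suc.IH[folded c_def, THEN conjunct2, THEN conjunct2]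
  have U: "[:0, 1:]\<^sup>2 * ?S (Suc n) - smult b (?U n) = ?U (Suc n)"
  proof -
    have "mixed_coeff c (Suc n) m = (if m = 0 then 0 else sq_coeff c (Suc n) (m - 1))
        - (c + 2 * of_nat m + 1)\<^sup>2 * sq_coeff c (Suc n) m - b * mixed_coeff c n m"
      if "m \<le> Suc n" for m
      using mixed_coeff_Suc[OF that] by (simp add: b_def)
    \<comment> \<open>The top index \<open>Suc (Suc n)\<close> is split off: there both sides have
      coefficient 1.\<close>
    then show ?thesis
      unfolding X_sq_mult_sum sum.atMost_Suc[of _ "Suc n"]
      by (simp add: smult_sum_right smult_diff_left sum_subtractf mixed_coeff_def
               del: sum.atMost_Suc)
  qed
  have S: "?U (Suc n) - smult b (?U n) + smult (b\<^sup>2) (?S n) = ?S (Suc (Suc n))"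
  proof -
    have *: "?S n = (\<Sum>m\<le>Suc n. smult (sq_coeff c n m) (?P m))" by simp
    have "sq_coeff c (Suc (Suc n)) m = mixed_coeff c (Suc n) m - b * mixed_coeff c n m
        + b\<^sup>2 * sq_coeff c n m"
      if "m \<le> Suc n" for m
      using sq_coeff_Suc_Suc[OF that] by (simp add: b_def)
    then show ?thesis
      unfolding * sum.atMost_Suc[of _ "Suc n"]
      by (simp add: smult_sum_right smult_diff_left smult_add_left sum_subtractf sum.distrib
            mixed_coeff_def del: sum.atMost_Suc)
  qed
  have D: "D r (Suc (Suc n)) = [:0, 1:] * D r (Suc n) - smult b (D r n)"
    by (simp add: b_def c_def)
  have "[:0, 1:] * D r (Suc (Suc n)) * D r (Suc n) =
      [:0, 1:]\<^sup>2 * (D r (Suc n))\<^sup>2 - smult b ([:0, 1:] * D r (Suc n) * D r n)"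
    unfolding D by (simp add: power2_eq_square algebra_simps del: D.simps)
  then have mixed: "[:0, 1:] * D r (Suc (Suc n)) * D r (Suc n) = ?U (Suc n)"
    by (simp only: IH U)
  \<comment> \<open>Squaring the recurrence yields the mixed product twice; one copy is absorbed
    into the new mixed product.\<close>
  have "(D r (Suc (Suc n)))\<^sup>2 = [:0, 1:] * D r (Suc (Suc n)) * D r (Suc n)
      - smult b ([:0, 1:] * D r (Suc n) * D r n) + smult (b\<^sup>2) ((D r n)\<^sup>2)"
    unfolding D by (simp add: power2_eq_square algebra_simps smult_diff_right del: D.simps)
  then have "(D r (Suc (Suc n)))\<^sup>2 = ?S (Suc (Suc n))"
    by (simp only: IH S mixed)
  with IH mixed show ?case
    unfolding c_def by blast
qed

text \<open>With n = m + k, the falling factorial of length k from n + c + m ends at c + 2m + 1, so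
  read upwards it is the first Pochhammer symbol of \<open>sq_coeff\<close>.\<close>

lemma sq_coeff_eq_gbinomial:
  assumes "m \<le> n"
  shows "sq_coeff c n m = ((of_nat n + c + of_nat m) gchoose (n - m)) * (-1) ^ (n - m)
    * (\<Prod>j = m + 1..n. of_nat j * (c + of_nat j))"
proof -
  obtain k where n: "n = m + k"
    using assms le_Suc_ex by blast
  have prod: "(\<Prod>j = m + 1..m + k. of_nat j * (c + of_nat j)) =
      pochhammer (of_nat m + 1) k * pochhammer (c + of_nat m + 1) k"
    by (induction k) (simp_all add: pochhammer_Suc algebra_simps)
  have "(of_nat n + c + of_nat m) gchoose k = pochhammer (c + 2 * of_nat m + 1) k / fact k"
    by (simp add: gbinomial_pochhammer' n algebra_simps)
  then show ?thesis
    unfolding sq_coeff_def n prod by simp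
qed

theorem theorem3p3:
  fixes r :: complex and n :: nat
  shows "(D r n)\<^sup>2 =
    (\<Sum>m = 0..n.
      smult (((of_nat n + 2 * r + of_nat m) gchoose (n - m)) * (-1) ^ (n - m)
             * (\<Prod>j = m + 1..n. of_nat j * (2 * r + of_nat j)))
        (\<Prod>k = 1..m. [:0, 1:]\<^sup>2 + [:(2 * r + 2 * of_nat k - 1)\<^sup>2:]))"
proof -
  have "(D r n)\<^sup>2 = (\<Sum>m\<le>n. smult (sq_coeff (2 * r) n m) (shifted_square_prod (2 * r) m))"
    using D_sq_and_mixed_expansion by blast
  also have "\<dots> = (\<Sum>m = 0..n.
      smult (((of_nat n + 2 * r + of_nat m) gchoose (n - m)) * (-1) ^ (n - m)
             * (\<Prod>j = m + 1..n. of_nat j * (2 * r + of_nat j)))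
        (shifted_square_prod (2 * r) m))"
    unfolding atMost_atLeast0 by (intro sum.cong refl) (simp add: sq_coeff_eq_gbinomial)
  finally show ?thesis
    unfolding shifted_square_prod_def .
qed

end
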